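(* Let $(R,+,\cdot)$ be a hyperring and $e\in R$. Then the quotient $R/\lambda_e^{*}$, with the operations $\lambda_e^{*}(a)\oplus\lambda_e^{*}(b)=\lambda_e^{*}(c)$ for any $c\in\lambda_e^{*}(a)+\lambda_e^{*}(b)$ and $\lambda_e^{*}(a)\otimes\lambda_e^{*}(b)=\lambda_e^{*}(d)$ for any $d\in\lambda_e^{*}(a)\cdot\lambda_e^{*}(b)$, is a ring with identity $\lambda_e^{*}(e)$.
   Context: A hyperoperation on a non-empty set $H$ is a map $\circ$ from $H\times H$ to the non-empty subsets of $H$; for non-empty $A,B\subseteq H$, $A\circ B=\bigcup_{a\in A,b\in B}a\circ b$, and elements are identified with singletons. $(H,\circ)$ is a semi-hypergroup if $x\circ(y\circ z)=(x\circ y)\circ z$ for all $x,y,z$, and a hypergroup if moreover $x\circ H=H\circ x=H$ for all $x\in H$. A hyperring $(R,+,\cdot)$ consists of a hypergroup $(R,+)$ (not assumed commutative) and a semi-hypergroup $(R,\cdot)$ (no unit assumed, not assumed commutative) such that $x\cdot(y+z)=x\cdot y+x\cdot z$ and $(x+y)\cdot z=x\cdot z+y\cdot z$ for all $x,y,z\in R$. For $n\in\mathbb{N}=\{1,2,\dots\}$, $k_i\in\mathbb{N}$ and $x_{ij}\in R$, $\sum_{i=1}^{n}\prod_{j=1}^{k_i}x_{ij}$ denotes the subset of $R$ obtained by the iterated hyperoperations, in the indicated order (a product with one factor $x$ is $\{x\}$). $S_n$ is the symmetric group on $\{1,\dots,n\}$. $x\,\alpha_{+}\,y$ iff there exist $n\in\mathbb{N}$,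 $(k_1,\dots,k_n)\in\mathbb{N}^n$, $\sigma\in S_n$ and elements $x_{ij}\in R$ such that $x\in\sum_{i=1}^n\prod_{j=1}^{k_i}x_{ij}$ and $y\in\sum_{i=1}^n A_{\sigma(i)}$, where $A_i=\prod_{j=1}^{k_i}x_{ij}$. Condition $\mathfrak{P}_e$: a pair of expressions $\big(\sum_{i=1}^m\prod_{j=1}^{k_i}x_{ij},\ \sum_{i=1}^m\prod_{t=1}^{k'_i}y_{it}\big)$ satisfies $\mathfrak{P}_e$ if one of the following holds: (1) $k_i=k'_i$ and $x_{ij}=y_{ij}$ for all $i,j$; (2) there exist $i_1,\dots,i_d\in\{1,\dots,m\}$ such that for every $i\notin\{i_1,\dots,i_d\}$ one has $k_i=k'_i$ and $x_{it}=y_{it}$ for all $1\le t\le k'_i$, and for every $i\in\{i_1,\dots,i_d\}$ there are $p_i,l_i\in\mathbb{N}$ with $1\le p_i\le l_i\le k'_i$ and $k'_i=k_i+(l_i-p_i+1)$ such that $y_{it}=x_{it}$ if $1\le t<p_i$, $y_{it}=e$ if $p_i\le t\le l_i$, and $y_{it}=x_{i\,(t+p_i-l_i-1)}$ if $l_i<t\le k'_i$ (i.e. a block of consecutive $e$'s is inserted in the $i$-th product). For $m\ge1$, $\Re_e^m$ is the set of all pairs $(A,B)$ and $(B,A)$ where $A=\sum_{i=1}^m\prod_{j=1}^{k_i}x_{ij}$, $B=\sum_{i=1}^m\prod_{t=1}^{k'_i}y_{it}$ and the pair $(A,B)$ satisfies $\mathfrak{P}_e$. Define $x\,(\lambda^e_\times)_m\,y$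 iff there is $(A,B)\in\Re_e^m$ with $x\in A$, $y\in B$; $\lambda^e_\times=\bigcup_{m\ge1}(\lambda^e_\times)_m$; and $\lambda_e=\lambda^e_\times\cup\alpha_+$. $\lambda_e^{*}$ is the transitive closure of $\lambda_e$ (an equivalence relation), and $\lambda_e^*(a)$ is the class of $a$. *)

theory Defs
  imports "HOL-Algebra.Ring" "HOL-Combinatorics.Permutations"
begin

type_synonym 'a hyperop = "'a \<Rightarrow> 'a \<Rightarrow> 'a set"

definition set_op :: "'a hyperop \<Rightarrow> 'a set \<Rightarrow> 'a set \<Rightarrow> 'a set" where
  "set_op f A B = (\<Union>a\<in>A. \<Union>b\<in>B. f a b)"

locale hyperoperation =
  fixes H :: "'a set" and f :: "'a hyperop"
  assumes nonempty: "H \<noteq> {}"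
    and closed: "\<lbrakk>x \<in> H; y \<in> H\<rbrakk> \<Longrightarrow> f x y \<subseteq> H"
    and value_nonempty: "\<lbrakk>x \<in> H; y \<in> H\<rbrakk> \<Longrightarrow> f x y \<noteq> {}"

locale semihypergroup = hyperoperation +
  assumes assoc: "\<lbrakk>x \<in> H; y \<in> H; z \<in> H\<rbrakk> \<Longrightarrow> set_op f {x} (f y z) = set_op f (f x y) {z}"

locale hypergroup = semihypergroup +
  assumes reproduction_left: "x \<in> H \<Longrightarrow> set_op f {x} H = H"
    and reproduction_right: "x \<in> H \<Longrightarrow> set_op f H {x} = H"

locale hyperring =
  add: hypergroup R hadd + mult: semihypergroup R hmul
  for R :: "'a set" and hadd :: "'a hyperop" and hmul :: "'a hyperop" +
  assumes distrib_left: "\<lbrakk>x \<in> R; y \<in> R; z \<in> R\<rbrakk> \<Longrightarrow>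
      set_op hmul {x} (hadd y z) = set_op hadd (hmul x y) (hmul x z)"
    and distrib_right: "\<lbrakk>x \<in> R; y \<in> R; z \<in> R\<rbrakk> \<Longrightarrow>
      set_op hmul (hadd x y) {z} = set_op hadd (hmul x z) (hmul y z)"

text \<open>Families are indexed from 1. The value at length 0 is never used: all lengths below
  are required to be positive.\<close>

fun iterate :: "'a hyperop \<Rightarrow> (nat \<Rightarrow> 'a set) \<Rightarrow> nat \<Rightarrow> 'a set" where
  "iterate f A 0 = {}"
| "iterate f A (Suc 0) = A 1"
| "iterate f A (Suc (Suc n)) = set_op f (iterate f A (Suc n)) (A (Suc (Suc n)))"

definition prod_set :: "'a hyperop \<Rightarrow> (nat \<Rightarrow> 'a) \<Rightarrow> nat \<Rightarrow> 'a set" where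
  "prod_set hmul x k = iterate hmul (\<lambda>j. {x j}) k"

definition sum_prod ::
  "'a hyperop \<Rightarrow> 'a hyperop \<Rightarrow> nat \<Rightarrow> (nat \<Rightarrow> nat) \<Rightarrow> (nat \<Rightarrow> nat \<Rightarrow> 'a) \<Rightarrow> 'a set" where
  "sum_prod hadd hmul n k x = iterate hadd (\<lambda>i. prod_set hmul (x i) (k i)) n"

text \<open>The expression with \<open>n\<close> summands, the \<open>i\<close>-th being the product of
  \<open>x i 1, \<dots>, x i (k i)\<close>, has positive lengths and all its entries in \<open>R\<close>.\<close>

definition is_expr :: "'a set \<Rightarrow> nat \<Rightarrow> (nat \<Rightarrow> nat) \<Rightarrow> (nat \<Rightarrow> nat \<Rightarrow> 'a) \<Rightarrow> bool" where
  "is_expr R n k x \<longleftrightarrow>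
    1 \<le> n \<and> (\<forall>i\<in>{1..n}. 1 \<le> k i \<and> (\<forall>j\<in>{1..k i}. x i j \<in> R))"

definition alpha_plus :: "'a set \<Rightarrow> 'a hyperop \<Rightarrow> 'a hyperop \<Rightarrow> 'a rel" where
  "alpha_plus R hadd hmul = {(u, v). \<exists>n k \<sigma> x.
      is_expr R n k x \<and> \<sigma> permutes {1..n} \<and>
      u \<in> sum_prod hadd hmul n k x \<and>
      v \<in> iterate hadd (\<lambda>i. prod_set hmul (x (\<sigma> i)) (k (\<sigma> i))) n}"

definition cond_P ::
  "'a \<Rightarrow> nat \<Rightarrow> (nat \<Rightarrow> nat) \<Rightarrow> (nat \<Rightarrow> nat \<Rightarrow> 'a) \<Rightarrow> (nat \<Rightarrow> nat) \<Rightarrow> (nat \<Rightarrow> nat \<Rightarrow> 'a) \<Rightarrow> bool" where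
  "cond_P e m k x k' y \<longleftrightarrow>
    (\<forall>i\<in>{1..m}. k i = k' i \<and> (\<forall>j\<in>{1..k i}. x i j = y i j)) \<or>
    (\<exists>I. I \<noteq> {} \<and> I \<subseteq> {1..m} \<and>
      (\<forall>i\<in>{1..m} - I. k i = k' i \<and> (\<forall>t\<in>{1..k' i}. x i t = y i t)) \<and>
      (\<forall>i\<in>I. \<exists>p l. 1 \<le> p \<and> p \<le> l \<and> l \<le> k' i \<and> k' i = k i + (l - p + 1) \<and>
        (\<forall>t\<in>{1..k' i}.
          (t < p \<longrightarrow> y i t = x i t) \<and>
          (p \<le> t \<and> t \<le> l \<longrightarrow> y i t = e) \<and>
          (l < t \<longrightarrow> y i t = x i (t + p - l - 1)))))"

definition Re_rel :: "'a set \<Rightarrow> 'a hyperop \<Rightarrow> 'a hyperop \<Rightarrow> 'a \<Rightarrow> nat \<Rightarrow> ('a set) rel" where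
  "Re_rel R hadd hmul e m =
    (let P = {(sum_prod hadd hmul m k x, sum_prod hadd hmul m k' y) | k x k' y.
                is_expr R m k x \<and> is_expr R m k' y \<and> cond_P e m k x k' y}
     in P \<union> P\<inverse>)"

definition lambda_times_at :: "'a set \<Rightarrow> 'a hyperop \<Rightarrow> 'a hyperop \<Rightarrow> 'a \<Rightarrow> nat \<Rightarrow> 'a rel" where
  "lambda_times_at R hadd hmul e m = {(u, v). \<exists>(A, B)\<in>Re_rel R hadd hmul e m. u \<in> A \<and> v \<in> B}"

definition lambda_times :: "'a set \<Rightarrow> 'a hyperop \<Rightarrow> 'a hyperop \<Rightarrow> 'a \<Rightarrow> 'a rel" where
  "lambda_times R hadd hmul e = (\<Union>m\<in>{1..}. lambda_times_at R hadd hmul e m)"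

definition lambda_rel :: "'a set \<Rightarrow> 'a hyperop \<Rightarrow> 'a hyperop \<Rightarrow> 'a \<Rightarrow> 'a rel" where
  "lambda_rel R hadd hmul e = lambda_times R hadd hmul e \<union> alpha_plus R hadd hmul"

definition lambda_star :: "'a set \<Rightarrow> 'a hyperop \<Rightarrow> 'a hyperop \<Rightarrow> 'a \<Rightarrow> 'a rel" where
  "lambda_star R hadd hmul e = (lambda_rel R hadd hmul e)\<^sup>+"

definition lambda_class :: "'a set \<Rightarrow> 'a hyperop \<Rightarrow> 'a hyperop \<Rightarrow> 'a \<Rightarrow> 'a \<Rightarrow> 'a set" where
  "lambda_class R hadd hmul e a = lambda_star R hadd hmul e `` {a}"

context hyperring
begin

lemma iterate_subset:
  assumes f: "\<And>a b. \<lbrakk>a \<in> R; b \<in> R\<rbrakk> \<Longrightarrow> f a b \<subseteq> R"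
    and "1 \<le> n" "\<forall>i\<in>{1..n}. A i \<subseteq> R"
  shows "iterate f A n \<subseteq> R"
  using assms(2,3)
proof (induction n rule: nat_induct_at_least)
  case base
  then show ?case by simp
next
  case (Suc n)
  then obtain m where m: "n = Suc m" by (cases n) auto
  have "iterate f A n \<subseteq> R" "A (Suc n) \<subseteq> R" using Suc by auto
  then have "set_op f (iterate f A n) (A (Suc n)) \<subseteq> R"
    unfolding set_op_def by (intro UN_least f) blast+
  then show ?case by (simp add: m)
qed

lemma prod_set_subset:
  assumes "1 \<le> k" "\<forall>j\<in>{1..k}. x j \<in> R"
  shows "prod_set hmul x k \<subseteq> R"
  unfolding prod_set_def by (rule iterate_subset) (use assms mult.closed in auto)

lemma sum_prod_subset: "is_expr R n k x \<Longrightarrow> sum_prod hadd hmul n k x \<subseteq> R"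
  unfolding sum_prod_def
  by (rule iterate_subset)
    (use add.closed prod_set_subset in \<open>auto simp: is_expr_def\<close>)

lemma is_expr_permute:
  assumes "is_expr R n k x" "\<sigma> permutes {1..n}"
  shows "is_expr R n (\<lambda>i. k (\<sigma> i)) (\<lambda>i. x (\<sigma> i))"
  using assms permutes_in_image[OF assms(2)] unfolding is_expr_def by blast

lemma alpha_plus_subset: "alpha_plus R hadd hmul \<subseteq> R \<times> R"
proof (rule subrelI)
  fix u v assume "(u, v) \<in> alpha_plus R hadd hmul"
  then obtain n k \<sigma> x where *: "is_expr R n k x" "\<sigma> permutes {1..n}"
      "u \<in> sum_prod hadd hmul n k x"
      "v \<in> sum_prod hadd hmul n (\<lambda>i. k (\<sigma> i)) (\<lambda>i. x (\<sigma> i))"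
    unfolding alpha_plus_def sum_prod_def by auto
  show "(u, v) \<in> R \<times> R"
    using sum_prod_subset[OF *(1)] sum_prod_subset[OF is_expr_permute[OF *(1,2)]] *(3,4) by auto
qed

lemma alpha_plus_refl:
  assumes "x \<in> R"
  shows "(x, x) \<in> alpha_plus R hadd hmul"
proof -
  have "is_expr R 1 (\<lambda>_. 1) (\<lambda>_ _. x)" "id permutes {1..1::nat}"
    "x \<in> sum_prod hadd hmul 1 (\<lambda>_. 1) (\<lambda>_ _. x)"
    using assms by (simp_all add: is_expr_def sum_prod_def prod_set_def permutes_id)
  moreover from this(3) have
    "x \<in> iterate hadd (\<lambda>i. prod_set hmul ((\<lambda>_ _. x) (id i)) ((\<lambda>_. 1) (id i))) 1"
    unfolding sum_prod_def .
  ultimately show ?thesis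
    unfolding alpha_plus_def mem_Collect_eq prod.case by (intro exI conjI)
qed

lemma alpha_plus_sym:
  assumes "(u, v) \<in> alpha_plus R hadd hmul"
  shows "(v, u) \<in> alpha_plus R hadd hmul"
proof -
  obtain n k \<sigma> x where *: "is_expr R n k x" "\<sigma> permutes {1..n}"
      "u \<in> sum_prod hadd hmul n k x"
      "v \<in> iterate hadd (\<lambda>i. prod_set hmul (x (\<sigma> i)) (k (\<sigma> i))) n"
    using assms unfolding alpha_plus_def by blast
  have "v \<in> sum_prod hadd hmul n (\<lambda>i. k (\<sigma> i)) (\<lambda>i. x (\<sigma> i))"
    using * unfolding sum_prod_def by simp
  moreover have "u \<in> iterate hadd (\<lambda>i. prod_set hmul (x (\<sigma> (inv_into UNIV \<sigma> i))) (k (\<sigma> (inv_into UNIV \<sigma> i)))) n"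
    using * unfolding sum_prod_def by (simp add: permutes_inverses)
  ultimately show ?thesis
    using is_expr_permute[OF *(1,2)] permutes_inv[OF *(2)] unfolding alpha_plus_def by fast
qed

lemma Re_rel_subset:
  assumes "(A, B) \<in> Re_rel R hadd hmul e m"
  shows "A \<subseteq> R" "B \<subseteq> R"
  using assms sum_prod_subset unfolding Re_rel_def Let_def by auto

lemma Re_rel_sym: "(A, B) \<in> Re_rel R hadd hmul e m \<Longrightarrow> (B, A) \<in> Re_rel R hadd hmul e m"
  unfolding Re_rel_def Let_def Un_iff converse_iff by (subst disj_commute)

lemma lambda_times_subset: "lambda_times R hadd hmul e \<subseteq> R \<times> R"
  unfolding lambda_times_def lambda_times_at_def using Re_rel_subset by fast

lemma lambda_times_sym: "sym (lambda_times R hadd hmul e)"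
  unfolding sym_def lambda_times_def lambda_times_at_def using Re_rel_sym by fast

theorem equiv_lambda_star: "equiv R (lambda_star R hadd hmul e)"
proof (rule equivI)
  have sub: "lambda_rel R hadd hmul e \<subseteq> R \<times> R"
    unfolding lambda_rel_def using lambda_times_subset alpha_plus_subset by blast
  show "lambda_star R hadd hmul e \<subseteq> R \<times> R"
    unfolding lambda_star_def by (rule trancl_subset_Sigma[OF sub])
  show "refl_on R (lambda_star R hadd hmul e)"
    unfolding refl_on_def lambda_star_def lambda_rel_def using alpha_plus_refl by blast
  have "sym (lambda_rel R hadd hmul e)"
    unfolding lambda_rel_def
    using lambda_times_sym alpha_plus_sym by (intro sym_Un) (auto intro: symI)
  then show "sym (lambda_star R hadd hmul e)"
    unfolding lambda_star_def by (rule sym_trancl)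
  show "trans (lambda_star R hadd hmul e)"
    unfolding lambda_star_def by (rule trans_trancl)
qed

end

text \<open>The operation induced by \<open>f\<close> on classes: when all \<open>c \<in> X \<circ> Y\<close> have the same class,
  the union below is that class. Independence of the choice of \<open>c\<close> is not built in and has to
  be asserted separately.\<close>

definition class_op ::
  "'a set \<Rightarrow> 'a hyperop \<Rightarrow> 'a hyperop \<Rightarrow> 'a \<Rightarrow> 'a hyperop \<Rightarrow> 'a set \<Rightarrow> 'a set \<Rightarrow> 'a set" where
  "class_op R hadd hmul e f X Y = (\<Union>c\<in>set_op f X Y. lambda_class R hadd hmul e c)"

text \<open>The \<open>ring\<close> record needs a named zero; it is the neutral element of the induced addition.\<close>

definition lambda_quotient :: "'a set \<Rightarrow> 'a hyperop \<Rightarrow> 'a hyperop \<Rightarrow> 'a \<Rightarrow> 'a set ring" where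
  "lambda_quotient R hadd hmul e =
    \<lparr>carrier = R // lambda_star R hadd hmul e,
     monoid.mult = class_op R hadd hmul e hmul,
     one = lambda_class R hadd hmul e e,
     zero = (THE Z. Z \<in> R // lambda_star R hadd hmul e \<and>
               (\<forall>X\<in>R // lambda_star R hadd hmul e.
                  class_op R hadd hmul e hadd Z X = X \<and> class_op R hadd hmul e hadd X Z = X)),
     ring.add = class_op R hadd hmul e hadd\<rparr>"

end

theory Submission
  imports Defs
begin

text \<open>
  Write \<open>L\<close> for the transitive closure of \<open>\<lambda>\<^sub>e\<close>. Everything rests on one fact: \<open>L\<close> is \<^emph>\<open>strongly
  regular\<close>, that is, if \<open>a L a'\<close> and \<open>b L b'\<close>, then \<^emph>\<open>every\<close> element of \<open>a + b\<close> is related to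
  \<^emph>\<open>every\<close> element of \<open>a' + b'\<close>, and likewise for products (\<open>star_add\<close>, \<open>star_mult\<close>). Strong
  regularity makes the induced operations on classes single-valued (\<open>class_op_eq\<close>), and then each
  ring law is obtained by choosing representatives inside the hyperring.

  Strong regularity holds because translating a sum of products by an element \<open>w\<close> gives a sum of
  products again: \<open>E + w\<close> has one more summand, and by distributivity \<open>E \<cdot> w\<close> and \<open>w \<cdot> E\<close> arise by
  appending or prepending the factor \<open>w\<close> to every product of \<open>E\<close>. If two expressions differ by a
  permutation of summands, or by blocks of \<open>e\<close> inserted in some products, then so do their
  translates. Adding \<open>w\<close> on the left reduces to adding it on the right, because a single step of
  \<open>\<alpha>\<^sub>+\<close> relates the elements of \<open>a + b\<close> to those of \<open>b + a\<close>.

  The remaining ring structure has three sources. Addition is commutative because of \<open>\<alpha>\<^sub>+\<close>.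
  Neutral element and inverses come from reproduction: \<open>b \<in> a + R\<close> says that the equation
  \<open>[a] \<oplus> X = [b]\<close> is solvable, and a commutative semigroup in which all such equations are solvable
  is a group. Finally, \<open>[e]\<close> is the identity because the product \<open>a\<close> with one factor becomes
  \<open>e \<cdot> a\<close> or \<open>a \<cdot> e\<close> by inserting one \<open>e\<close>.
\<close>

section \<open>Block insertion in a single product\<close>

definition block_inserted :: "'a \<Rightarrow> nat \<Rightarrow> nat \<Rightarrow> nat \<Rightarrow> (nat \<Rightarrow> 'a) \<Rightarrow> nat \<Rightarrow> (nat \<Rightarrow> 'a) \<Rightarrow> bool" where
  "block_inserted e p l k x k' y \<longleftrightarrow>
    1 \<le> p \<and> p \<le> l \<and> l \<le> k' \<and> k' = k + (l - p + 1) \<and>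
    (\<forall>t\<in>{1..k'}.
      (t < p \<longrightarrow> y t = x t) \<and>
      (p \<le> t \<and> t \<le> l \<longrightarrow> y t = e) \<and>
      (l < t \<longrightarrow> y t = x (t + p - l - 1)))"

text \<open>The relation that the condition \<open>\<PP>\<^sub>e\<close> imposes on the two \<open>i\<close>-th products, for one fixed
  \<open>i\<close>. With it the condition becomes a plain statement about all \<open>i\<close>, without an index set.\<close>

definition block_insertion :: "'a \<Rightarrow> nat \<Rightarrow> (nat \<Rightarrow> 'a) \<Rightarrow> nat \<Rightarrow> (nat \<Rightarrow> 'a) \<Rightarrow> bool" where
  "block_insertion e k x k' y \<longleftrightarrow>
    (k = k' \<and> (\<forall>j\<in>{1..k}. x j = y j)) \<or> (\<exists>p l. block_inserted e p l k x k' y)"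

lemma cond_P_iff_block_insertion:
  "cond_P e m k x k' y \<longleftrightarrow> (\<forall>i\<in>{1..m}. block_insertion e (k i) (x i) (k' i) (y i))"
    (is "?P \<longleftrightarrow> ?B")
proof
  assume ?P
  then show ?B
    unfolding cond_P_def block_insertion_def block_inserted_def[symmetric] by (metis DiffI)
next
  assume B: ?B
  define I where "I = {i\<in>{1..m}. \<not> (k i = k' i \<and> (\<forall>j\<in>{1..k i}. x i j = y i j))}"
  \<comment> \<open>The second alternative of the condition asks for a non-empty index set, so two expressions
    without any insertion have to use the first one.\<close>
  show ?P
  proof (cases "I = {}")
    case True
    then have "\<forall>i\<in>{1..m}. k i = k' i \<and> (\<forall>j\<in>{1..k i}. x i j = y i j)"
      unfolding I_def by blast
    then show ?thesis
      unfolding cond_P_def by (rule disjI1)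
  next
    case False
    have sub: "I \<subseteq> {1..m}" unfolding I_def by blast
    have same: "\<forall>i\<in>{1..m} - I. k i = k' i \<and> (\<forall>t\<in>{1..k' i}. x i t = y i t)"
      unfolding I_def by auto
    have ins: "\<forall>i\<in>I. \<exists>p l. block_inserted e p l (k i) (x i) (k' i) (y i)"
      using B unfolding I_def block_insertion_def by blast
    show ?thesis
      unfolding cond_P_def block_inserted_def[symmetric]
      by (intro disjI2 exI[of _ I] conjI False sub same ins)
  qed
qed

lemma block_insertion_refl: "block_insertion e k x k x"
  by (simp add: block_insertion_def)

definition prepend :: "'a \<Rightarrow> (nat \<Rightarrow> 'a) \<Rightarrow> nat \<Rightarrow> 'a" where
  "prepend w x j = (if j = 1 then w else x (j - 1))"

text \<open>The block stays where it is, and the new last entries correspond: a position behind the block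
  is matched with the one shifted back by the block length \<open>k' - k\<close>, which takes \<open>Suc k'\<close> to
  \<open>Suc k\<close>.\<close>

lemma block_inserted_append:
  assumes "block_inserted e p l k x k' y"
  shows "block_inserted e p l (Suc k) (x(Suc k := w)) (Suc k') (y(Suc k' := w))"
proof -
  have pl: "1 \<le> p" "p \<le> l" "l \<le> k'" "k' = k + (l - p + 1)"
    and y: "\<And>t. t \<in> {1..k'} \<Longrightarrow> (t < p \<longrightarrow> y t = x t) \<and> (p \<le> t \<and> t \<le> l \<longrightarrow> y t = e) \<and>
          (l < t \<longrightarrow> y t = x (t + p - l - 1))"
    using assms unfolding block_inserted_def by blast+
  have "(t < p \<longrightarrow> (y(Suc k' := w)) t = (x(Suc k := w)) t) \<and>
      (p \<le> t \<and> t \<le> l \<longrightarrow> (y(Suc k' := w)) t = e) \<and>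
      (l < t \<longrightarrow> (y(Suc k' := w)) t = (x(Suc k := w)) (t + p - l - 1))"
    if "t \<in> {1..Suc k'}" for t
  proof (cases "t = Suc k'")
    case True
    then have "l < t" "t + p - l - 1 = Suc k"
      using pl by auto
    then show ?thesis using pl True by simp
  next
    case False
    with that have t: "t \<in> {1..k'}" by auto
    have "t + p - l - 1 \<noteq> Suc k" "t < p \<Longrightarrow> t \<noteq> Suc k"
      using t pl by auto
    then show ?thesis
      using y[OF t] False by simp
  qed
  then show ?thesis
    unfolding block_inserted_def using pl by simp
qed

lemma block_insertion_append:
  assumes "block_insertion e k x k' y"
  shows "block_insertion e (Suc k) (x(Suc k := w)) (Suc k') (y(Suc k' := w))"
proof (cases "k = k' \<and> (\<forall>j\<in>{1..k}. x j = y j)")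
  case True
  then show ?thesis by (simp add: block_insertion_def)
next
  case False
  then obtain p l where "block_inserted e p l k x k' y"
    using assms unfolding block_insertion_def by blast
  from block_inserted_append[OF this] show ?thesis
    unfolding block_insertion_def by blast
qed

text \<open>Every old entry moves up by one, and the block with it.\<close>

lemma block_inserted_prepend:
  assumes "block_inserted e p l k x k' y"
  shows "block_inserted e (Suc p) (Suc l) (Suc k) (prepend w x) (Suc k') (prepend w y)"
proof -
  have pl: "1 \<le> p" "p \<le> l" "l \<le> k'" "k' = k + (l - p + 1)"
    and y: "\<And>t. t \<in> {1..k'} \<Longrightarrow> (t < p \<longrightarrow> y t = x t) \<and> (p \<le> t \<and> t \<le> l \<longrightarrow> y t = e) \<and>
          (l < t \<longrightarrow> y t = x (t + p - l - 1))"
    using assms unfolding block_inserted_def by blast+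
  have "(t < Suc p \<longrightarrow> prepend w y t = prepend w x t) \<and>
      (Suc p \<le> t \<and> t \<le> Suc l \<longrightarrow> prepend w y t = e) \<and>
      (Suc l < t \<longrightarrow> prepend w y t = prepend w x (t + Suc p - Suc l - 1))"
    if "t \<in> {1..Suc k'}" for t
  proof (cases "t = 1")
    case True
    then show ?thesis using pl by (auto simp: prepend_def)
  next
    case False
    with that have t: "t - 1 \<in> {1..k'}" by auto
    show ?thesis
      using y[OF t] pl False that by (auto simp: prepend_def)
  qed
  then show ?thesis
    unfolding block_inserted_def using pl by simp
qed

lemma block_insertion_prepend:
  assumes "block_insertion e k x k' y"
  shows "block_insertion e (Suc k) (prepend w x) (Suc k') (prepend w y)"
proof (cases "k = k' \<and> (\<forall>j\<in>{1..k}. x j = y j)")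
  case True
  then have "x (j - 1) = y (j - 1)" if "j \<noteq> 1" "j \<in> {1..Suc k}" for j
    using that by (cases j) auto
  then show ?thesis using True by (auto simp: block_insertion_def prepend_def)
next
  case False
  then obtain p l where "block_inserted e p l k x k' y"
    using assms unfolding block_insertion_def by blast
  from block_inserted_prepend[OF this] show ?thesis
    unfolding block_insertion_def by blast
qed

section \<open>Hyperoperations on subsets\<close>

lemma set_op_iff: "c \<in> set_op f A B \<longleftrightarrow> (\<exists>a\<in>A. \<exists>b\<in>B. c \<in> f a b)"
  by (auto simp: set_op_def)

lemma set_op_singletons [simp]: "set_op f {a} {b} = f a b"
  by (simp add: set_op_def)

lemma (in semihypergroup) set_op_assoc:
  assumes "A \<subseteq> H" "B \<subseteq> H" "C \<subseteq> H"
  shows "set_op f A (set_op f B C) = set_op f (set_op f A B) C"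
proof -
  have "set_op f A (set_op f B C) = (\<Union>a\<in>A. \<Union>b\<in>B. \<Union>c\<in>C. set_op f {a} (f b c))"
    by (auto simp: set_op_def)
  also have "\<dots> = (\<Union>a\<in>A. \<Union>b\<in>B. \<Union>c\<in>C. set_op f (f a b) {c})"
    using assms assoc by (intro SUP_cong refl) blast
  also have "\<dots> = set_op f (set_op f A B) C"
    by (auto simp: set_op_def)
  finally show ?thesis .
qed

lemma iterate_Suc: "1 \<le> n \<Longrightarrow> iterate f A (Suc n) = set_op f (iterate f A n) (A (Suc n))"
  by (cases n) simp_all

lemma iterate_cong: "(\<And>i. i \<in> {1..n} \<Longrightarrow> A i = B i) \<Longrightarrow> iterate f A n = iterate f B n"
proof (induction n)
  case (Suc n)
  then show ?case by (cases n) auto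
qed simp

section \<open>Translates of sums of products\<close>

lemma prod_set_append:
  assumes "1 \<le> k"
  shows "prod_set g (x(Suc k := w)) (Suc k) = set_op g (prod_set g x k) {w}"
proof -
  have "iterate g (\<lambda>j. {(x(Suc k := w)) j}) k = iterate g (\<lambda>j. {x j}) k"
    by (rule iterate_cong) auto
  then show ?thesis
    unfolding prod_set_def iterate_Suc[OF assms] by simp
qed

lemma sum_prod_append:
  assumes "1 \<le> n"
  shows "sum_prod h g (Suc n) (k(Suc n := 1)) (x(Suc n := (\<lambda>_. w)))
       = set_op h (sum_prod h g n k x) {w}"
proof -
  let ?A = "\<lambda>i. prod_set g ((x(Suc n := (\<lambda>_. w))) i) ((k(Suc n := 1)) i)"
  have "iterate h ?A n = iterate h (\<lambda>i. prod_set g (x i) (k i)) n"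
    by (rule iterate_cong) auto
  moreover have "?A (Suc n) = {w}"
    by (simp add: prod_set_def)
  ultimately show ?thesis
    unfolding sum_prod_def iterate_Suc[OF assms] by (simp del: fun_upd_apply)
qed

lemma is_expr_append_summand:
  "is_expr R n k x \<Longrightarrow> w \<in> R \<Longrightarrow> is_expr R (Suc n) (k(Suc n := 1)) (x(Suc n := (\<lambda>_. w)))"
  by (auto simp: is_expr_def)

lemma is_expr_append_factor:
  "is_expr R n k x \<Longrightarrow> w \<in> R \<Longrightarrow> is_expr R n (\<lambda>i. Suc (k i)) (\<lambda>i. (x i)(Suc (k i) := w))"
  by (auto simp: is_expr_def)

lemma is_expr_prepend_factor:
  assumes "is_expr R n k x" "w \<in> R"
  shows "is_expr R n (\<lambda>i. Suc (k i)) (\<lambda>i. prepend w (x i))"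
proof -
  have "prepend w (x i) j \<in> R" if "i \<in> {1..n}" "j \<in> {1..Suc (k i)}" for i j
  proof (cases "j = 1")
    case False
    then have "j - 1 \<in> {1..k i}" using that by auto
    then show ?thesis using assms that False by (auto simp: is_expr_def prepend_def)
  qed (use assms in \<open>simp add: prepend_def\<close>)
  then show ?thesis using assms(1) by (auto simp: is_expr_def)
qed

context hyperring
begin

lemma sum_element:
  assumes "a \<in> R" "b \<in> R"
  obtains c where "c \<in> hadd a b" "c \<in> R"
  using add.value_nonempty[OF assms] add.closed[OF assms] by auto

lemma product_element:
  assumes "a \<in> R" "b \<in> R"
  obtains c where "c \<in> hmul a b" "c \<in> R"
  using mult.value_nonempty[OF assms] mult.closed[OF assms] by auto

lemma prod_set_prepend:
  assumes "1 \<le> k" "\<forall>j\<in>{1..k}. x j \<in> R" "w \<in> R"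
  shows "prod_set hmul (prepend w x) (Suc k) = set_op hmul {w} (prod_set hmul x k)"
  using assms(1,2)
proof (induction k rule: nat_induct_at_least)
  case base
  then show ?case by (simp add: prod_set_def prepend_def)
next
  case (Suc k)
  have "prod_set hmul (prepend w x) (Suc (Suc k))
      = set_op hmul (prod_set hmul (prepend w x) (Suc k)) {x (Suc k)}"
    by (simp add: prod_set_def prepend_def)
  also have "\<dots> = set_op hmul (set_op hmul {w} (prod_set hmul x k)) {x (Suc k)}"
    using Suc by simp
  also have "\<dots> = set_op hmul {w} (set_op hmul (prod_set hmul x k) {x (Suc k)})"
    using Suc assms(3) prod_set_subset[of k x] by (intro mult.set_op_assoc[symmetric]) auto
  also have "set_op hmul (prod_set hmul x k) {x (Suc k)} = prod_set hmul x (Suc k)"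
    using Suc by (simp add: prod_set_def iterate_Suc)
  finally show ?case .
qed

text \<open>Distributivity carries over to subsets only because the translating factor is a single
  element: in \<open>A \<cdot> C + B \<cdot> C\<close> the two summands could use different elements of \<open>C\<close>.\<close>

lemma set_distrib_right:
  assumes "A \<subseteq> R" "B \<subseteq> R" "w \<in> R"
  shows "set_op hmul (set_op hadd A B) {w} = set_op hadd (set_op hmul A {w}) (set_op hmul B {w})"
proof -
  have "set_op hmul (set_op hadd A B) {w} = (\<Union>a\<in>A. \<Union>b\<in>B. set_op hmul (hadd a b) {w})"
    by (auto simp: set_op_def)
  also have "\<dots> = (\<Union>a\<in>A. \<Union>b\<in>B. set_op hadd (hmul a w) (hmul b w))"
    using assms distrib_right by (intro SUP_cong refl) blast
  also have "\<dots> = set_op hadd (set_op hmul A {w}) (set_op hmul B {w})"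
    by (auto simp: set_op_def)
  finally show ?thesis .
qed

lemma set_distrib_left:
  assumes "A \<subseteq> R" "B \<subseteq> R" "w \<in> R"
  shows "set_op hmul {w} (set_op hadd A B) = set_op hadd (set_op hmul {w} A) (set_op hmul {w} B)"
proof -
  have "set_op hmul {w} (set_op hadd A B) = (\<Union>a\<in>A. \<Union>b\<in>B. set_op hmul {w} (hadd a b))"
    by (auto simp: set_op_def)
  also have "\<dots> = (\<Union>a\<in>A. \<Union>b\<in>B. set_op hadd (hmul w a) (hmul w b))"
    using assms distrib_left by (intro SUP_cong refl) blast
  also have "\<dots> = set_op hadd (set_op hmul {w} A) (set_op hmul {w} B)"
    by (auto simp: set_op_def)
  finally show ?thesis .
qed

lemma iterate_distrib:
  assumes "1 \<le> n" "\<forall>i\<in>{1..n}. A i \<subseteq> R" "w \<in> R"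
  shows "set_op hmul (iterate hadd A n) {w} = iterate hadd (\<lambda>i. set_op hmul (A i) {w}) n"
    and "set_op hmul {w} (iterate hadd A n) = iterate hadd (\<lambda>i. set_op hmul {w} (A i)) n"
proof -
  have "set_op hmul (iterate hadd A n) {w} = iterate hadd (\<lambda>i. set_op hmul (A i) {w}) n \<and>
      set_op hmul {w} (iterate hadd A n) = iterate hadd (\<lambda>i. set_op hmul {w} (A i)) n"
    using assms(1,2)
  proof (induction n rule: nat_induct_at_least)
    case (Suc n)
    have "iterate hadd A n \<subseteq> R" "A (Suc n) \<subseteq> R"
      using iterate_subset[OF add.closed] Suc by auto
    then show ?case
      using Suc assms(3) by (simp add: iterate_Suc set_distrib_right set_distrib_left)
  qed simp
  then show "set_op hmul (iterate hadd A n) {w} = iterate hadd (\<lambda>i. set_op hmul (A i) {w}) n"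
    and "set_op hmul {w} (iterate hadd A n) = iterate hadd (\<lambda>i. set_op hmul {w} (A i)) n"
    by auto
qed

lemma sum_prod_append_factor:
  assumes "is_expr R n k x" "w \<in> R"
  shows "sum_prod hadd hmul n (\<lambda>i. Suc (k i)) (\<lambda>i. (x i)(Suc (k i) := w))
       = set_op hmul (sum_prod hadd hmul n k x) {w}"
proof -
  have sub: "\<forall>i\<in>{1..n}. prod_set hmul (x i) (k i) \<subseteq> R"
    using assms prod_set_subset by (auto simp: is_expr_def)
  have n: "1 \<le> n" using assms by (simp add: is_expr_def)
  show ?thesis
    unfolding sum_prod_def iterate_distrib(1)[OF n sub assms(2)]
    by (intro iterate_cong prod_set_append) (use assms in \<open>auto simp: is_expr_def\<close>)
qed

lemma sum_prod_prepend_factor: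
  assumes "is_expr R n k x" "w \<in> R"
  shows "sum_prod hadd hmul n (\<lambda>i. Suc (k i)) (\<lambda>i. prepend w (x i))
       = set_op hmul {w} (sum_prod hadd hmul n k x)"
proof -
  have sub: "\<forall>i\<in>{1..n}. prod_set hmul (x i) (k i) \<subseteq> R"
    using assms prod_set_subset by (auto simp: is_expr_def)
  have n: "1 \<le> n" using assms by (simp add: is_expr_def)
  show ?thesis
    unfolding sum_prod_def iterate_distrib(2)[OF n sub assms(2)]
    by (intro iterate_cong prod_set_prepend) (use assms in \<open>auto simp: is_expr_def\<close>)
qed

end

section \<open>Strong regularity\<close>

locale pointed_hyperring = hyperring +
  fixes e :: 'a
  assumes e_in: "e \<in> R"
begin

abbreviation step :: "'a rel" where "step \<equiv> lambda_rel R hadd hmul e"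
abbreviation star :: "'a rel" where "star \<equiv> lambda_star R hadd hmul e"
abbreviation cls :: "'a \<Rightarrow> 'a set" where "cls \<equiv> lambda_class R hadd hmul e"

lemma step_permuteI:
  assumes "is_expr R n k x" "\<sigma> permutes {1..n}" "u \<in> sum_prod hadd hmul n k x"
    "v \<in> sum_prod hadd hmul n (\<lambda>i. k (\<sigma> i)) (\<lambda>i. x (\<sigma> i))"
  shows "(u, v) \<in> step"
proof -
  have "(u, v) \<in> alpha_plus R hadd hmul"
    using assms unfolding alpha_plus_def sum_prod_def by blast
  then show ?thesis by (simp add: lambda_rel_def)
qed

lemma step_insertI:
  assumes "is_expr R m k x" "is_expr R m k' y"
    "\<forall>i\<in>{1..m}. block_insertion e (k i) (x i) (k' i) (y i)"
    "u \<in> sum_prod hadd hmul m k x" "v \<in> sum_prod hadd hmul m k' y"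
  shows "(u, v) \<in> step" "(v, u) \<in> step"
proof -
  have m: "m \<in> {1..}" using assms(1) by (simp add: is_expr_def)
  have "cond_P e m k x k' y"
    using assms(3) by (simp add: cond_P_iff_block_insertion)
  then have Re: "(sum_prod hadd hmul m k x, sum_prod hadd hmul m k' y) \<in> Re_rel R hadd hmul e m"
    unfolding Re_rel_def Let_def
    by (intro UnI1 CollectI exI conjI) (rule refl, rule assms, rule assms)
  have "(u, v) \<in> lambda_times_at R hadd hmul e m"
    unfolding lambda_times_at_def mem_Collect_eq prod.case
    by (rule bexI[OF _ Re]) (use assms(4,5) in simp)
  with m have "(u, v) \<in> lambda_times R hadd hmul e"
    unfolding lambda_times_def by (rule UN_I)
  moreover from this have "(v, u) \<in> lambda_times R hadd hmul e"
    by (rule symD[OF lambda_times_sym])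
  ultimately show "(u, v) \<in> step" "(v, u) \<in> step"
    by (simp_all add: lambda_rel_def)
qed

lemma Re_rel_cases:
  assumes "(A, B) \<in> Re_rel R hadd hmul e m"
  obtains (forward) k x k' y where "A = sum_prod hadd hmul m k x" "B = sum_prod hadd hmul m k' y"
        "is_expr R m k x" "is_expr R m k' y" "cond_P e m k x k' y"
    | (backward) k x k' y where "B = sum_prod hadd hmul m k x" "A = sum_prod hadd hmul m k' y"
        "is_expr R m k x" "is_expr R m k' y" "cond_P e m k x k' y"
  using assms
  unfolding Re_rel_def Let_def Un_iff converse_iff
proof (elim disjE)
  assume "(A, B) \<in> {(sum_prod hadd hmul m k x, sum_prod hadd hmul m k' y) | k x k' y.
      is_expr R m k x \<and> is_expr R m k' y \<and> cond_P e m k x k' y}"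
  then show ?thesis by (elim CollectE exE conjE) (rule forward, auto)
next
  assume "(B, A) \<in> {(sum_prod hadd hmul m k x, sum_prod hadd hmul m k' y) | k x k' y.
      is_expr R m k x \<and> is_expr R m k' y \<and> cond_P e m k x k' y}"
  then show ?thesis by (elim CollectE exE conjE) (rule backward, auto)
qed

lemma step_cases:
  assumes "(u, v) \<in> step"
  obtains (permute) n k \<sigma> x where "is_expr R n k x" "\<sigma> permutes {1..n}"
      "u \<in> sum_prod hadd hmul n k x"
      "v \<in> sum_prod hadd hmul n (\<lambda>i. k (\<sigma> i)) (\<lambda>i. x (\<sigma> i))"
  | (insert) m k x k' y where "is_expr R m k x" "is_expr R m k' y"
      "\<forall>i\<in>{1..m}. block_insertion e (k i) (x i) (k' i) (y i)"
      "u \<in> sum_prod hadd hmul m k x" "v \<in> sum_prod hadd hmul m k' y"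
  | (remove) m k x k' y where "is_expr R m k x" "is_expr R m k' y"
      "\<forall>i\<in>{1..m}. block_insertion e (k i) (x i) (k' i) (y i)"
      "v \<in> sum_prod hadd hmul m k x" "u \<in> sum_prod hadd hmul m k' y"
proof -
  consider "(u, v) \<in> alpha_plus R hadd hmul" | "(u, v) \<in> lambda_times R hadd hmul e"
    using assms by (auto simp: lambda_rel_def)
  then show ?thesis
  proof cases
    case 1
    then obtain n k \<sigma> x where "is_expr R n k x" "\<sigma> permutes {1..n}"
      "u \<in> sum_prod hadd hmul n k x"
      "v \<in> iterate hadd (\<lambda>i. prod_set hmul (x (\<sigma> i)) (k (\<sigma> i))) n"
      unfolding alpha_plus_def mem_Collect_eq prod.case by (elim exE conjE)
    then show ?thesis using permute by (simp add: sum_prod_def)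
  next
    case 2
    then obtain m A B where AB: "(A, B) \<in> Re_rel R hadd hmul e m" "u \<in> A" "v \<in> B"
      unfolding lambda_times_def lambda_times_at_def by auto
    from AB(1) show ?thesis
    proof (cases rule: Re_rel_cases)
      case (forward k x k' y)
      show ?thesis
        by (rule insert[OF forward(3,4)])
          (use forward AB in \<open>simp_all add: cond_P_iff_block_insertion\<close>)
    next
      case (backward k x k' y)
      show ?thesis
        by (rule remove[OF backward(3,4)])
          (use backward AB in \<open>simp_all add: cond_P_iff_block_insertion\<close>)
    qed
  qed
qed

text \<open>A translation \<open>T\<close> of subsets respects one step as soon as it is realised on expressions by
  a rewriting \<open>(n, k, x) \<mapsto> (N n, K n k, X n k x)\<close> that commutes with permuting summands and
  preserves block insertions. Its instances are addition of \<open>w\<close> on the right and multiplication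
  by \<open>w\<close> on either side.\<close>

lemma step_translate:
  assumes expr: "\<And>n k x. is_expr R n k x \<Longrightarrow> is_expr R (N n) (K n k) (X n k x)"
    and sum: "\<And>n k x. is_expr R n k x \<Longrightarrow>
      sum_prod hadd hmul (N n) (K n k) (X n k x) = T (sum_prod hadd hmul n k x)"
    and T: "\<And>A u. u \<in> A \<Longrightarrow> T {u} \<subseteq> T A"
    and permuted: "\<And>n \<sigma> k x. \<sigma> permutes {1..n} \<Longrightarrow> \<sigma> permutes {1..N n} \<and>
      K n (\<lambda>i. k (\<sigma> i)) = (\<lambda>i. K n k (\<sigma> i)) \<and>
      X n (\<lambda>i. k (\<sigma> i)) (\<lambda>i. x (\<sigma> i)) = (\<lambda>i. X n k x (\<sigma> i))"
    and inserted: "\<And>n k x k' y i. i \<in> {1..N n} \<Longrightarrow>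
      (\<forall>i\<in>{1..n}. block_insertion e (k i) (x i) (k' i) (y i)) \<Longrightarrow>
      block_insertion e (K n k i) (X n k x i) (K n k' i) (X n k' y i)"
    and uv: "(u, v) \<in> step" and c: "c \<in> T {u}" and d: "d \<in> T {v}"
  shows "(c, d) \<in> step"
  using uv
proof (cases rule: step_cases)
  case (permute n k \<sigma> x)
  note \<sigma> = permuted[OF permute(2), of k x]
  have "is_expr R n (\<lambda>i. k (\<sigma> i)) (\<lambda>i. x (\<sigma> i))"
    using permute(1,2) by (rule is_expr_permute)
  then have "d \<in> sum_prod hadd hmul (N n) (\<lambda>i. K n k (\<sigma> i)) (\<lambda>i. X n k x (\<sigma> i))"
    using sum[of n "\<lambda>i. k (\<sigma> i)" "\<lambda>i. x (\<sigma> i)"] T[OF permute(4)] d \<sigma> by auto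
  moreover have "c \<in> sum_prod hadd hmul (N n) (K n k) (X n k x)"
    using sum[OF permute(1)] T[OF permute(3)] c by auto
  ultimately show ?thesis
    using step_permuteI[OF expr[OF permute(1)]] \<sigma> by blast
next
  case (insert m k x k' y)
  have "c \<in> sum_prod hadd hmul (N m) (K m k) (X m k x)"
    "d \<in> sum_prod hadd hmul (N m) (K m k') (X m k' y)"
    using sum[OF insert(1)] sum[OF insert(2)] T[OF insert(4)] T[OF insert(5)] c d by auto
  moreover have "\<forall>i\<in>{1..N m}. block_insertion e (K m k i) (X m k x i) (K m k' i) (X m k' y i)"
    using inserted insert(3) by blast
  ultimately show ?thesis
    using step_insertI(1)[OF expr[OF insert(1)] expr[OF insert(2)]] by blast
next
  case (remove m k x k' y)
  have "d \<in> sum_prod hadd hmul (N m) (K m k) (X m k x)"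
    "c \<in> sum_prod hadd hmul (N m) (K m k') (X m k' y)"
    using sum[OF remove(1)] sum[OF remove(2)] T[OF remove(4)] T[OF remove(5)] c d by auto
  moreover have "\<forall>i\<in>{1..N m}. block_insertion e (K m k i) (X m k x i) (K m k' i) (X m k' y i)"
    using inserted remove(3) by blast
  ultimately show ?thesis
    using step_insertI(2)[OF expr[OF remove(1)] expr[OF remove(2)]] by blast
qed

lemma step_add_right:
  assumes "(u, v) \<in> step" "w \<in> R" "c \<in> hadd u w" "d \<in> hadd v w"
  shows "(c, d) \<in> step"
proof (rule step_translate[where N = Suc and K = "\<lambda>n k. k(Suc n := 1)"
      and X = "\<lambda>n k x. x(Suc n := (\<lambda>_. w))" and T = "\<lambda>A. set_op hadd A {w}", OF _ _ _ _ _ assms(1)])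
  fix n :: nat and \<sigma> k :: "nat \<Rightarrow> nat" and x :: "nat \<Rightarrow> nat \<Rightarrow> 'a"
  assume \<sigma>: "\<sigma> permutes {1..n}"
  have perm: "\<sigma> permutes {1..Suc n}"
    by (rule permutes_subset[OF \<sigma>]) auto
  \<comment> \<open>Only the new index is sent to \<open>Suc n\<close>, so appending commutes with reindexing along \<open>\<sigma>\<close>.\<close>
  have fix_new: "\<sigma> i = Suc n \<longleftrightarrow> i = Suc n" for i
    using inj_eq[OF permutes_inj[OF \<sigma>], of i "Suc n"] permutes_not_in[OF \<sigma>, of "Suc n"] by simp
  show "\<sigma> permutes {1..Suc n} \<and>
      (\<lambda>i. k (\<sigma> i))(Suc n := 1) = (\<lambda>i. (k(Suc n := 1)) (\<sigma> i)) \<and>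
      (\<lambda>i. x (\<sigma> i))(Suc n := (\<lambda>_. w)) = (\<lambda>i. (x(Suc n := (\<lambda>_. w))) (\<sigma> i))"
    by (simp add: perm fix_new fun_eq_iff del: One_nat_def)
next
  show "is_expr R (Suc n) (k(Suc n := 1)) (x(Suc n := (\<lambda>_. w)))" if "is_expr R n k x" for n k x
    using that assms(2) by (rule is_expr_append_summand)
  show "sum_prod hadd hmul (Suc n) (k(Suc n := 1)) (x(Suc n := (\<lambda>_. w)))
      = set_op hadd (sum_prod hadd hmul n k x) {w}" if "is_expr R n k x" for n k x
    using that by (intro sum_prod_append) (simp add: is_expr_def)
  show "set_op hadd {u} {w} \<subseteq> set_op hadd A {w}" if "u \<in> A" for u A
    using that by (auto simp: set_op_iff)
  show "block_insertion e ((k(Suc n := 1)) i) ((x(Suc n := (\<lambda>_. w))) i)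
      ((k'(Suc n := 1)) i) ((y(Suc n := (\<lambda>_. w))) i)"
    if "i \<in> {1..Suc n}" "\<forall>i\<in>{1..n}. block_insertion e (k i) (x i) (k' i) (y i)"
    for n :: nat and k x k' y i
    using that by (cases "i = Suc n") (auto simp: block_insertion_refl)
qed (use assms in simp_all)

lemma step_mult_right:
  assumes "(u, v) \<in> step" "w \<in> R" "c \<in> hmul u w" "d \<in> hmul v w"
  shows "(c, d) \<in> step"
  by (rule step_translate[where N = "\<lambda>n. n" and K = "\<lambda>n k i. Suc (k i)"
      and X = "\<lambda>n k x i. (x i)(Suc (k i) := w)" and T = "\<lambda>A. set_op hmul A {w}", OF _ _ _ _ _ assms(1)])
    (use assms in \<open>auto simp: set_op_iff sum_prod_append_factor intro: is_expr_append_factor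
      block_insertion_append\<close>)

lemma step_mult_left:
  assumes "(u, v) \<in> step" "w \<in> R" "c \<in> hmul w u" "d \<in> hmul w v"
  shows "(c, d) \<in> step"
  by (rule step_translate[where N = "\<lambda>n. n" and K = "\<lambda>n k i. Suc (k i)"
      and X = "\<lambda>n k x i. prepend w (x i)" and T = "\<lambda>A. set_op hmul {w} A", OF _ _ _ _ _ assms(1)])
    (use assms in \<open>auto simp: set_op_iff sum_prod_prepend_factor intro: is_expr_prepend_factor
      block_insertion_prepend\<close>)

text \<open>This is the step of \<open>\<alpha>\<^sub>+\<close> that swaps two summands with one factor each.\<close>

lemma step_add_commute:
  assumes "a \<in> R" "b \<in> R" "c \<in> hadd a b" "d \<in> hadd b a"
  shows "(c, d) \<in> step"
proof -
  let ?x = "\<lambda>i (j::nat). if i = (1::nat) then a else b"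
  have "is_expr R 2 (\<lambda>_. 1) ?x"
    using assms by (auto simp: is_expr_def)
  moreover have "transpose 1 2 permutes {1..2::nat}"
    by (rule permutes_swap_id) auto
  moreover have "c \<in> sum_prod hadd hmul 2 (\<lambda>_. 1) ?x"
    using assms by (simp add: sum_prod_def prod_set_def numeral_2_eq_2)
  moreover have "d \<in> sum_prod hadd hmul 2 (\<lambda>_. 1) (\<lambda>i. ?x (transpose 1 2 i))"
    using assms by (simp add: sum_prod_def prod_set_def numeral_2_eq_2 transpose_def)
  ultimately show ?thesis
    by (rule step_permuteI)
qed

text \<open>The product with the single factor \<open>a\<close> turns into \<open>e \<cdot> a\<close> or \<open>a \<cdot> e\<close> by inserting one \<open>e\<close>,
  at position \<open>1\<close> or \<open>2\<close>.\<close>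

lemma step_unit:
  assumes "a \<in> R"
  shows "c \<in> hmul e a \<Longrightarrow> (a, c) \<in> step" "c \<in> hmul a e \<Longrightarrow> (a, c) \<in> step"
proof -
  have a: "is_expr R 1 (\<lambda>_. 1) (\<lambda>_ _. a)" "a \<in> sum_prod hadd hmul 1 (\<lambda>_. 1) (\<lambda>_ _. a)"
    using assms by (auto simp: is_expr_def sum_prod_def prod_set_def)
  show "(a, c) \<in> step" if c: "c \<in> hmul e a"
  proof (rule step_insertI(1)[OF a(1) _ _ a(2)])
    let ?y = "\<lambda>(_::nat) j. if j = (1::nat) then e else a"
    show "is_expr R 1 (\<lambda>_. 2) ?y"
      using assms e_in by (auto simp: is_expr_def)
    have "block_insertion e 1 (\<lambda>_. a) 2 (?y i)" for i
      unfolding block_insertion_def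
      by (intro disjI2 exI[of _ 1]) (simp add: block_inserted_def)
    then show "\<forall>i\<in>{1..1}. block_insertion e 1 (\<lambda>_. a) 2 (?y i)" by blast
    show "c \<in> sum_prod hadd hmul 1 (\<lambda>_. 2) ?y"
      using c by (simp add: sum_prod_def prod_set_def numeral_2_eq_2)
  qed
  show "(a, c) \<in> step" if c: "c \<in> hmul a e"
  proof (rule step_insertI(1)[OF a(1) _ _ a(2)])
    let ?y = "\<lambda>(_::nat) j. if j = (1::nat) then a else e"
    show "is_expr R 1 (\<lambda>_. 2) ?y"
      using assms e_in by (auto simp: is_expr_def)
    have "block_insertion e 1 (\<lambda>_. a) 2 (?y i)" for i
      unfolding block_insertion_def
      by (intro disjI2 exI[of _ 2]) (simp add: block_inserted_def)
    then show "\<forall>i\<in>{1..1}. block_insertion e 1 (\<lambda>_. a) 2 (?y i)" by blast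
    show "c \<in> sum_prod hadd hmul 1 (\<lambda>_. 2) ?y"
      using c by (simp add: sum_prod_def prod_set_def numeral_2_eq_2)
  qed
qed

lemma star_in:
  assumes "(a, b) \<in> star"
  shows "a \<in> R" "b \<in> R"
  using assms equiv_type[OF equiv_lambda_star] by blast+

lemma star_refl: "a \<in> R \<Longrightarrow> (a, a) \<in> star"
  using equiv_lambda_star by (auto simp: equiv_def refl_on_def)

lemma star_trans: "(a, b) \<in> star \<Longrightarrow> (b, c) \<in> star \<Longrightarrow> (a, c) \<in> star"
  unfolding lambda_star_def by (rule trancl_trans)

lemma step_star: "(a, b) \<in> step \<Longrightarrow> (a, b) \<in> star"
  unfolding lambda_star_def by blast

text \<open>Along a chain of steps one chooses an element of \<open>F v\<close> for each intermediate \<open>v\<close>, which is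
  possible because hyperoperations have non-empty values.\<close>

lemma star_translate:
  assumes F: "\<And>u v c d. (u, v) \<in> step \<Longrightarrow> c \<in> F u \<Longrightarrow> d \<in> F v \<Longrightarrow> (c, d) \<in> star"
    and ne: "\<And>u. u \<in> R \<Longrightarrow> F u \<noteq> {}"
    and uv: "(u, v) \<in> star" and c: "c \<in> F u" and d: "d \<in> F v"
  shows "(c, d) \<in> star"
proof -
  have "\<forall>d\<in>F v. (c, d) \<in> star" if "(u, v) \<in> step\<^sup>+"
    using that
  proof induction
    case (base v)
    then show ?case using F c by blast
  next
    case (step v v')
    have "v \<in> R" using step(1) star_in unfolding lambda_star_def by blast
    then obtain d where "d \<in> F v" using ne by blast
    then show ?case using step F star_trans by blast
  qed
  then show ?thesis using uv d unfolding lambda_star_def by blast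
qed

lemma star_add:
  assumes "(a, a') \<in> star" "(b, b') \<in> star" "c \<in> hadd a b" "d \<in> hadd a' b'"
  shows "(c, d) \<in> star"
proof -
  have R: "a \<in> R" "a' \<in> R" "b \<in> R" "b' \<in> R"
    using assms star_in by blast+
  have right: "(c, d) \<in> star" if "(u, v) \<in> star" "w \<in> R" "c \<in> hadd u w" "d \<in> hadd v w" for u v w c d
    by (rule star_translate[where F = "\<lambda>u. hadd u w", OF _ _ that(1,3,4)])
      (use step_star step_add_right add.value_nonempty that(2) in blast)+
  \<comment> \<open>The chain \<open>a + b\<close>, \<open>a' + b\<close>, \<open>b + a'\<close>, \<open>b' + a'\<close>, \<open>a' + b'\<close> avoids translations from the left.\<close>
  obtain p where p: "p \<in> hadd a' b" using R(2,3) by (rule sum_element)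
  obtain q where q: "q \<in> hadd b a'" using R(3,2) by (rule sum_element)
  obtain r where r: "r \<in> hadd b' a'" using R(4,2) by (rule sum_element)
  have "(c, p) \<in> star" using right assms(1,3) R p by blast
  moreover have "(p, q) \<in> star" using step_add_commute R p q step_star by blast
  moreover have "(q, r) \<in> star" using right assms(2) R q r by blast
  moreover have "(r, d) \<in> star" using step_add_commute R r assms(4) step_star by blast
  ultimately show ?thesis using star_trans by blast
qed

lemma star_mult:
  assumes "(a, a') \<in> star" "(b, b') \<in> star" "c \<in> hmul a b" "d \<in> hmul a' b'"
  shows "(c, d) \<in> star"
proof -
  have R: "a' \<in> R" "b \<in> R"
    using assms star_in by blast+
  then obtain p where p: "p \<in> hmul a' b"
    using mult.value_nonempty by blast
  have "(c, p) \<in> star"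
    by (rule star_translate[where F = "\<lambda>u. hmul u b", OF _ _ assms(1,3) p])
      (use step_star step_mult_right mult.value_nonempty R in blast)+
  moreover have "(p, d) \<in> star"
    by (rule star_translate[where F = "\<lambda>u. hmul a' u", OF _ _ assms(2) p assms(4)])
      (use step_star step_mult_left mult.value_nonempty R in blast)+
  ultimately show ?thesis using star_trans by blast
qed

section \<open>The quotient ring\<close>

lemma cls_eqI: "(a, b) \<in> star \<Longrightarrow> cls a = cls b"
  unfolding lambda_class_def by (rule equiv_class_eq[OF equiv_lambda_star])

lemma mem_cls: "b \<in> cls a \<longleftrightarrow> (a, b) \<in> star"
  by (simp add: lambda_class_def)

abbreviation Q :: "'a set ring" where "Q \<equiv> lambda_quotient R hadd hmul e"

lemma carrier_Q: "X \<in> carrier Q \<longleftrightarrow> (\<exists>a\<in>R. X = cls a)"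
  by (auto simp: lambda_quotient_def lambda_class_def quotient_def)

lemma cls_in_carrier: "a \<in> R \<Longrightarrow> cls a \<in> carrier Q"
  by (auto simp: carrier_Q)

lemma carrier_cases:
  assumes "X \<in> carrier Q"
  obtains a where "a \<in> R" "X = cls a"
  using assms carrier_Q by auto

text \<open>The union defining \<open>class_op\<close> ranges over all representatives of both classes; strong
  regularity makes all its members equal.\<close>

lemma class_op_eq:
  assumes regular: "\<And>a a' b b' c d. (a, a') \<in> star \<Longrightarrow> (b, b') \<in> star \<Longrightarrow>
      c \<in> f a b \<Longrightarrow> d \<in> f a' b' \<Longrightarrow> (c, d) \<in> star"
    and c: "c \<in> set_op f (cls a) (cls b)"
  shows "class_op R hadd hmul e f (cls a) (cls b) = cls c"
proof -
  have "cls d = cls c" if d: "d \<in> set_op f (cls a) (cls b)" for d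
  proof -
    obtain a1 b1 a2 b2 where *: "(a, a1) \<in> star" "(b, b1) \<in> star" "c \<in> f a1 b1"
      "(a, a2) \<in> star" "(b, b2) \<in> star" "d \<in> f a2 b2"
      using c d by (auto simp: set_op_iff mem_cls)
    have "(a2, a1) \<in> star" "(b2, b1) \<in> star"
      using * star_trans equiv_lambda_star by (meson equivE symD)+
    then show ?thesis using regular * cls_eqI by blast
  qed
  then show ?thesis using c unfolding class_op_def by blast
qed

lemma add_class_op:
  "c \<in> set_op hadd (cls a) (cls b) \<Longrightarrow> cls a \<oplus>\<^bsub>Q\<^esub> cls b = cls c"
  using class_op_eq[of hadd, OF star_add] by (simp add: lambda_quotient_def)

lemma mult_class_op:
  "c \<in> set_op hmul (cls a) (cls b) \<Longrightarrow> cls a \<otimes>\<^bsub>Q\<^esub> cls b = cls c"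
  using class_op_eq[of hmul, OF star_mult] by (simp add: lambda_quotient_def)

lemma self_mem_cls: "a \<in> R \<Longrightarrow> a \<in> cls a"
  by (simp add: mem_cls star_refl)

lemma add_cls: "a \<in> R \<Longrightarrow> b \<in> R \<Longrightarrow> c \<in> hadd a b \<Longrightarrow> cls a \<oplus>\<^bsub>Q\<^esub> cls b = cls c"
  by (rule add_class_op) (use self_mem_cls in \<open>simp add: set_op_iff, blast\<close>)

lemma mult_cls: "a \<in> R \<Longrightarrow> b \<in> R \<Longrightarrow> c \<in> hmul a b \<Longrightarrow> cls a \<otimes>\<^bsub>Q\<^esub> cls b = cls c"
  by (rule mult_class_op) (use self_mem_cls in \<open>simp add: set_op_iff, blast\<close>)

lemma add_closed:
  assumes "X \<in> carrier Q" "Y \<in> carrier Q"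
  shows "X \<oplus>\<^bsub>Q\<^esub> Y \<in> carrier Q"
  using assms by (metis carrier_cases cls_in_carrier add_cls sum_element)

lemma mult_closed:
  assumes "X \<in> carrier Q" "Y \<in> carrier Q"
  shows "X \<otimes>\<^bsub>Q\<^esub> Y \<in> carrier Q"
  using assms by (metis carrier_cases cls_in_carrier mult_cls product_element)

lemma add_comm:
  assumes "X \<in> carrier Q" "Y \<in> carrier Q"
  shows "X \<oplus>\<^bsub>Q\<^esub> Y = Y \<oplus>\<^bsub>Q\<^esub> X"
proof -
  obtain a b where R: "a \<in> R" "b \<in> R" and XY: "X = cls a" "Y = cls b"
    using carrier_cases[OF assms(1)] carrier_cases[OF assms(2)] by metis
  obtain c where "c \<in> hadd a b" using R by (rule sum_element)
  moreover obtain d where "d \<in> hadd b a" using R(2,1) by (rule sum_element)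
  moreover from calculation have "cls c = cls d"
    using R step_add_commute step_star cls_eqI by blast
  ultimately show ?thesis
    using R XY add_cls by metis
qed

lemma add_assoc:
  assumes "X \<in> carrier Q" "Y \<in> carrier Q" "Z \<in> carrier Q"
  shows "(X \<oplus>\<^bsub>Q\<^esub> Y) \<oplus>\<^bsub>Q\<^esub> Z = X \<oplus>\<^bsub>Q\<^esub> (Y \<oplus>\<^bsub>Q\<^esub> Z)"
proof -
  obtain a b c where R: "a \<in> R" "b \<in> R" "c \<in> R" and XYZ: "X = cls a" "Y = cls b" "Z = cls c"
    using carrier_cases[OF assms(1)] carrier_cases[OF assms(2)] carrier_cases[OF assms(3)] by metis
  obtain p where p: "p \<in> hadd a b" "p \<in> R" using R(1,2) by (rule sum_element)
  obtain r where r: "r \<in> hadd p c" using p(2) R(3) by (rule sum_element)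
  then have "r \<in> set_op hadd {a} (hadd b c)"
    using add.assoc[OF R] p by (auto simp: set_op_iff)
  then obtain q where q: "q \<in> hadd b c" "r \<in> hadd a q" by (auto simp: set_op_iff)
  then have "q \<in> R" using R add.closed by blast
  then show ?thesis
    by (simp add: XYZ add_cls[OF R(1,2) p(1)] add_cls[OF p(2) R(3) r]
        add_cls[OF R(2,3) q(1)] add_cls[OF R(1) _ q(2)])
qed

lemma mult_assoc:
  assumes "X \<in> carrier Q" "Y \<in> carrier Q" "Z \<in> carrier Q"
  shows "(X \<otimes>\<^bsub>Q\<^esub> Y) \<otimes>\<^bsub>Q\<^esub> Z = X \<otimes>\<^bsub>Q\<^esub> (Y \<otimes>\<^bsub>Q\<^esub> Z)"
proof -
  obtain a b c where R: "a \<in> R" "b \<in> R" "c \<in> R" and XYZ: "X = cls a" "Y = cls b" "Z = cls c"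
    using carrier_cases[OF assms(1)] carrier_cases[OF assms(2)] carrier_cases[OF assms(3)] by metis
  obtain p where p: "p \<in> hmul a b" "p \<in> R" using R(1,2) by (rule product_element)
  obtain r where r: "r \<in> hmul p c" using p(2) R(3) by (rule product_element)
  then have "r \<in> set_op hmul {a} (hmul b c)"
    using mult.assoc[OF R] p by (auto simp: set_op_iff)
  then obtain q where q: "q \<in> hmul b c" "r \<in> hmul a q" by (auto simp: set_op_iff)
  then have "q \<in> R" using R mult.closed by blast
  then show ?thesis
    by (simp add: XYZ mult_cls[OF R(1,2) p(1)] mult_cls[OF p(2) R(3) r]
        mult_cls[OF R(2,3) q(1)] mult_cls[OF R(1) _ q(2)])
qed

lemma distrib:
  assumes "X \<in> carrier Q" "Y \<in> carrier Q" "Z \<in> carrier Q"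
  shows "(X \<oplus>\<^bsub>Q\<^esub> Y) \<otimes>\<^bsub>Q\<^esub> Z = X \<otimes>\<^bsub>Q\<^esub> Z \<oplus>\<^bsub>Q\<^esub> Y \<otimes>\<^bsub>Q\<^esub> Z"
    and "Z \<otimes>\<^bsub>Q\<^esub> (X \<oplus>\<^bsub>Q\<^esub> Y) = Z \<otimes>\<^bsub>Q\<^esub> X \<oplus>\<^bsub>Q\<^esub> Z \<otimes>\<^bsub>Q\<^esub> Y"
proof -
  obtain a b c where R: "a \<in> R" "b \<in> R" "c \<in> R" and XYZ: "X = cls a" "Y = cls b" "Z = cls c"
    using carrier_cases[OF assms(1)] carrier_cases[OF assms(2)] carrier_cases[OF assms(3)] by metis
  obtain p where p: "p \<in> hadd a b" "p \<in> R" using R(1,2) by (rule sum_element)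
  obtain r where r: "r \<in> hmul p c" using p(2) R(3) by (rule product_element)
  then have "r \<in> set_op hadd (hmul a c) (hmul b c)"
    using distrib_right[OF R] p by (auto simp: set_op_iff)
  then obtain q q' where q: "q \<in> hmul a c" "q' \<in> hmul b c" "r \<in> hadd q q'" by (auto simp: set_op_iff)
  then have "q \<in> R" "q' \<in> R" using R mult.closed by blast+
  then show "(X \<oplus>\<^bsub>Q\<^esub> Y) \<otimes>\<^bsub>Q\<^esub> Z = X \<otimes>\<^bsub>Q\<^esub> Z \<oplus>\<^bsub>Q\<^esub> Y \<otimes>\<^bsub>Q\<^esub> Z"
    by (simp add: XYZ add_cls[OF R(1,2) p(1)] mult_cls[OF p(2) R(3) r]
        mult_cls[OF R(1,3) q(1)] mult_cls[OF R(2,3) q(2)] add_cls[OF _ _ q(3)])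
  obtain s where s: "s \<in> hmul c p" using R(3) p(2) by (rule product_element)
  then have "s \<in> set_op hadd (hmul c a) (hmul c b)"
    using distrib_left[OF R(3,1,2)] p by (auto simp: set_op_iff)
  then obtain t t' where t: "t \<in> hmul c a" "t' \<in> hmul c b" "s \<in> hadd t t'" by (auto simp: set_op_iff)
  then have "t \<in> R" "t' \<in> R" using R mult.closed by blast+
  then show "Z \<otimes>\<^bsub>Q\<^esub> (X \<oplus>\<^bsub>Q\<^esub> Y) = Z \<otimes>\<^bsub>Q\<^esub> X \<oplus>\<^bsub>Q\<^esub> Z \<otimes>\<^bsub>Q\<^esub> Y"
    by (simp add: XYZ add_cls[OF R(1,2) p(1)] mult_cls[OF R(3) p(2) s]
        mult_cls[OF R(3,1) t(1)] mult_cls[OF R(3,2) t(2)] add_cls[OF _ _ t(3)])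
qed

lemma unit_cls:
  assumes "X \<in> carrier Q"
  shows "cls e \<otimes>\<^bsub>Q\<^esub> X = X" "X \<otimes>\<^bsub>Q\<^esub> cls e = X"
proof -
  obtain a where a: "a \<in> R" "X = cls a" using assms by (rule carrier_cases)
  obtain c where "c \<in> hmul e a" using e_in a(1) by (rule product_element)
  moreover obtain d where "d \<in> hmul a e" using a(1) e_in by (rule product_element)
  moreover from calculation have "cls a = cls c" "cls a = cls d"
    using a step_unit step_star cls_eqI by blast+
  ultimately show "cls e \<otimes>\<^bsub>Q\<^esub> X = X" "X \<otimes>\<^bsub>Q\<^esub> cls e = X"
    using a e_in mult_cls by metis+
qed

text \<open>Solvability is reproduction, \<open>b \<in> a + R\<close>, read in the quotient. It yields the neutral
  element as well as the inverses.\<close>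

lemma add_solvable:
  assumes "X \<in> carrier Q" "Y \<in> carrier Q"
  obtains Z where "Z \<in> carrier Q" "X \<oplus>\<^bsub>Q\<^esub> Z = Y"
proof -
  obtain a b where R: "a \<in> R" "b \<in> R" and XY: "X = cls a" "Y = cls b"
    using carrier_cases[OF assms(1)] carrier_cases[OF assms(2)] by metis
  have "b \<in> set_op hadd {a} R"
    using R by (simp add: add.reproduction_left)
  then obtain z where "z \<in> R" "b \<in> hadd a z"
    by (auto simp: set_op_iff)
  then show ?thesis using that[of "cls z"] R XY add_cls cls_in_carrier by simp
qed

text \<open>If \<open>[e] \<oplus> Z = [e]\<close>, then \<open>Z\<close> is neutral for every \<open>X\<close>, because \<open>X\<close> is a sum \<open>[e] \<oplus> Y\<close>.
  The neutral element is unique, so the definite description in the record denotes it.\<close>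

lemma zero_Q:
  "\<zero>\<^bsub>Q\<^esub> \<in> carrier Q \<and> (\<forall>X\<in>carrier Q. \<zero>\<^bsub>Q\<^esub> \<oplus>\<^bsub>Q\<^esub> X = X)"
proof -
  let ?neutral = "\<lambda>Z. Z \<in> carrier Q \<and> (\<forall>X\<in>carrier Q. Z \<oplus>\<^bsub>Q\<^esub> X = X \<and> X \<oplus>\<^bsub>Q\<^esub> Z = X)"
  have E: "cls e \<in> carrier Q" using e_in by (rule cls_in_carrier)
  obtain Z where Z: "Z \<in> carrier Q" "cls e \<oplus>\<^bsub>Q\<^esub> Z = cls e"
    using add_solvable[OF E E] .
  have "Z \<oplus>\<^bsub>Q\<^esub> X = X" if X: "X \<in> carrier Q" for X
  proof -
    obtain Y where Y: "Y \<in> carrier Q" "cls e \<oplus>\<^bsub>Q\<^esub> Y = X"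
      using add_solvable[OF E X] .
    have "Z \<oplus>\<^bsub>Q\<^esub> X = (cls e \<oplus>\<^bsub>Q\<^esub> Z) \<oplus>\<^bsub>Q\<^esub> Y"
      using Y Z E add_assoc add_comm by metis
    then show ?thesis using Y Z by simp
  qed
  then have "?neutral Z" using Z add_comm by auto
  moreover from this have "Z' = Z" if "?neutral Z'" for Z'
    using that by metis
  ultimately have "?neutral (THE Z. ?neutral Z)"
    by (rule theI)
  also have "(THE Z. ?neutral Z) = \<zero>\<^bsub>Q\<^esub>"
    by (simp add: lambda_quotient_def)
  finally show ?thesis by blast
qed

lemma one_Q: "\<one>\<^bsub>Q\<^esub> = cls e"
  by (simp add: lambda_quotient_def)

lemma ring_Q: "ring Q"
proof (rule ringI)
  show "abelian_group Q"
  proof (rule abelian_groupI)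
    fix X assume X: "X \<in> carrier Q"
    obtain Y where Y: "Y \<in> carrier Q" "X \<oplus>\<^bsub>Q\<^esub> Y = \<zero>\<^bsub>Q\<^esub>"
      using add_solvable[OF X] zero_Q by blast
    then show "\<exists>Y\<in>carrier Q. Y \<oplus>\<^bsub>Q\<^esub> X = \<zero>\<^bsub>Q\<^esub>"
      using add_comm[OF X Y(1)] by (intro bexI[of _ Y]) simp_all
  qed (use zero_Q add_closed add_assoc add_comm in auto)
  show "Group.monoid Q"
    by (rule Group.monoidI)
      (simp_all add: one_Q cls_in_carrier e_in mult_closed mult_assoc unit_cls)
qed (use distrib in auto)

end

theorem theorem2p8:
  fixes R :: "'a set" and hadd hmul :: "'a \<Rightarrow> 'a \<Rightarrow> 'a set" and e :: 'a
  assumes "hyperring R hadd hmul" and "e \<in> R"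
  shows "(\<forall>a\<in>R. \<forall>b\<in>R.
            \<forall>c\<in>set_op hadd (lambda_class R hadd hmul e a) (lambda_class R hadd hmul e b).
              lambda_class R hadd hmul e a \<oplus>\<^bsub>lambda_quotient R hadd hmul e\<^esub> lambda_class R hadd hmul e b
                = lambda_class R hadd hmul e c) \<and>
         (\<forall>a\<in>R. \<forall>b\<in>R.
            \<forall>d\<in>set_op hmul (lambda_class R hadd hmul e a) (lambda_class R hadd hmul e b).
              lambda_class R hadd hmul e a \<otimes>\<^bsub>lambda_quotient R hadd hmul e\<^esub> lambda_class R hadd hmul e b
                = lambda_class R hadd hmul e d) \<and>
         ring (lambda_quotient R hadd hmul e) \<and>
         \<one>\<^bsub>lambda_quotient R hadd hmul e\<^esub> = lambda_class R hadd hmul e e"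
proof -
  interpret pointed_hyperring R hadd hmul e
    using assms by (simp add: pointed_hyperring_def pointed_hyperring_axioms_def)
  show ?thesis
    using add_class_op mult_class_op ring_Q one_Q by blast
qed

end
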